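(* Let $v,d\ge0$ and let $\langle\mathbf{S}'\rangle,\langle\mathbf{S}''\rangle\in\mathbf{E}\langle v,d\rangle$ be characteristic minmatrices. Then: (a) $\langle\mathbf{S}'\rangle\vee\langle\mathbf{S}''\rangle=\langle\mathbf{S}'\rangle\cup\langle\mathbf{S}''\rangle$ (in particular the union is a characteristic minmatrix); (b) $\langle\mathbf{S}'\rangle\wedge\langle\mathbf{S}''\rangle\subseteq\langle\mathbf{S}'\rangle\cap\langle\mathbf{S}''\rangle$.
   Context: Language: variables $p_1,p_2,\dots$, constants $0,1$, connectives $\neg,\vee,\wedge$, modal operator $\lozenge$. $\mathbf{E}$ is the smallest set of formulas containing all tautologies and closed under modus ponens, uniform substitution and RE (from $\varphi\leftrightarrow\psi$ infer $\lozenge\varphi\leftrightarrow\lozenge\psi$); a classical modal logic is a set of formulas containing $\mathbf{E}$ closed under these rules. $\varphi\approx\psi$ means $\vdash_{\mathbf{E}}\varphi\leftrightarrow\psi$. $\mathcal{F}(v,d)$: formulas in $p_1,\dots,p_v$ of $\lozenge$-depth $\le d$. DCF: level-0 minterms are $\pm p_1\wedge\dots\wedge\pm p_v$; for $d\ge1$ the level-$d$ modal factors are $\lozenge\phi$ for all DCF formulas $\phi$ of $\mathcal{F}(v,d-1)$, and a level-$d$ minterm is a level-0 minterm conjoined with every level-$d$ modal factor, each plain or negated; DCF formulas of $\mathcal{F}(v,d)$ are disjunctions of sets of distinct level-$d$ minterms. Every formula of $\mathcal{F}(v,d)$ is $\approx$ to exactly one DCF formula, so each element of $\mathbf{E}[v,d]=\mathcal{F}(v,d)/\approx$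 (a "minmatrix") is identified with a set of level-$d$ minterms; disjunction/conjunction correspond to union/intersection, and $\vdash_{\mathbf{E}}\varphi\to\psi$ iff the minterm set of $\varphi$ is contained in that of $\psi$. For a classical modal logic $\mathbf{S}$, the characteristic minmatrix $\langle\mathbf{S}\rangle=\langle\mathbf{S}\rangle_{v,d}$ is the intersection of the minterm sets of all $\mathbf{S}$-theorems in $\mathcal{F}(v,d)$. $\mathbf{E}\langle v,d\rangle$ is the set of all characteristic minmatrices, ordered by inclusion, regarded as a lattice; $\vee$ and $\wedge$ denote its join and meet (the least upper bound and greatest lower bound within $\mathbf{E}\langle v,d\rangle$). *)

theory Defs
  imports "HOL-Algebra.Lattice"
begin

(* Var i stands for the variable p_(i+1), so p_1, ..., p_v are Var i with i < v. *)
datatype fm =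
    Var nat
  | Zero
  | One
  | Neg fm
  | Or fm fm
  | And fm fm
  | Dia fm

abbreviation Imp :: "fm \<Rightarrow> fm \<Rightarrow> fm" where
  "Imp \<phi> \<psi> \<equiv> Or (Neg \<phi>) \<psi>"

abbreviation Iff :: "fm \<Rightarrow> fm \<Rightarrow> fm" where
  "Iff \<phi> \<psi> \<equiv> And (Imp \<phi> \<psi>) (Imp \<psi> \<phi>)"

primrec subst :: "(nat \<Rightarrow> fm) \<Rightarrow> fm \<Rightarrow> fm" where
  "subst \<sigma> (Var i) = \<sigma> i"
| "subst \<sigma> Zero = Zero"
| "subst \<sigma> One = One"
| "subst \<sigma> (Neg \<phi>) = Neg (subst \<sigma> \<phi>)"
| "subst \<sigma> (Or \<phi> \<psi>) = Or (subst \<sigma> \<phi>) (subst \<sigma> \<psi>)"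
| "subst \<sigma> (And \<phi> \<psi>) = And (subst \<sigma> \<phi>) (subst \<sigma> \<psi>)"
| "subst \<sigma> (Dia \<phi>) = Dia (subst \<sigma> \<phi>)"

primrec vars :: "fm \<Rightarrow> nat set" where
  "vars (Var i) = {i}"
| "vars Zero = {}"
| "vars One = {}"
| "vars (Neg \<phi>) = vars \<phi>"
| "vars (Or \<phi> \<psi>) = vars \<phi> \<union> vars \<psi>"
| "vars (And \<phi> \<psi>) = vars \<phi> \<union> vars \<psi>"
| "vars (Dia \<phi>) = vars \<phi>"

primrec depth :: "fm \<Rightarrow> nat" where
  "depth (Var i) = 0"
| "depth Zero = 0"
| "depth One = 0"
| "depth (Neg \<phi>) = depth \<phi>"
| "depth (Or \<phi> \<psi>) = max (depth \<phi>) (depth \<psi>)"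
| "depth (And \<phi> \<psi>) = max (depth \<phi>) (depth \<psi>)"
| "depth (Dia \<phi>) = Suc (depth \<phi>)"

definition formulas :: "nat \<Rightarrow> nat \<Rightarrow> fm set" where
  "formulas v d = {\<phi>. vars \<phi> \<subseteq> {..<v} \<and> depth \<phi> \<le> d}"

(* Truth-functional evaluation: variables and formulas Dia \<phi> are the atoms. *)
primrec tval :: "(fm \<Rightarrow> bool) \<Rightarrow> fm \<Rightarrow> bool" where
  "tval V (Var i) \<longleftrightarrow> V (Var i)"
| "tval V Zero \<longleftrightarrow> False"
| "tval V One \<longleftrightarrow> True"
| "tval V (Neg \<phi>) \<longleftrightarrow> \<not> tval V \<phi>"
| "tval V (Or \<phi> \<psi>) \<longleftrightarrow> tval V \<phi> \<or> tval V \<psi>"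
| "tval V (And \<phi> \<psi>) \<longleftrightarrow> tval V \<phi> \<and> tval V \<psi>"
| "tval V (Dia \<phi>) \<longleftrightarrow> V (Dia \<phi>)"

definition tautology :: "fm \<Rightarrow> bool" where
  "tautology \<phi> \<longleftrightarrow> (\<forall>V. tval V \<phi>)"

inductive_set E :: "fm set" where
  taut: "tautology \<phi> \<Longrightarrow> \<phi> \<in> E"
| mp: "\<phi> \<in> E \<Longrightarrow> Imp \<phi> \<psi> \<in> E \<Longrightarrow> \<psi> \<in> E"
| us: "\<phi> \<in> E \<Longrightarrow> subst \<sigma> \<phi> \<in> E"
| re: "Iff \<phi> \<psi> \<in> E \<Longrightarrow> Iff (Dia \<phi>) (Dia \<psi>) \<in> E"

definition classical_modal_logic :: "fm set \<Rightarrow> bool" where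
  "classical_modal_logic S \<longleftrightarrow>
     E \<subseteq> S \<and>
     (\<forall>\<phi> \<psi>. \<phi> \<in> S \<longrightarrow> Imp \<phi> \<psi> \<in> S \<longrightarrow> \<psi> \<in> S) \<and>
     (\<forall>\<phi> \<sigma>. \<phi> \<in> S \<longrightarrow> subst \<sigma> \<phi> \<in> S) \<and>
     (\<forall>\<phi> \<psi>. Iff \<phi> \<psi> \<in> S \<longrightarrow> Iff (Dia \<phi>) (Dia \<psi>) \<in> S)"

definition E_equiv :: "fm \<Rightarrow> fm \<Rightarrow> bool" (infix \<open>\<approx>\<close> 50) where
  "\<phi> \<approx> \<psi> \<longleftrightarrow> Iff \<phi> \<psi> \<in> E"

fun big_and :: "fm list \<Rightarrow> fm" where
  "big_and [] = One"
| "big_and [\<phi>] = \<phi>"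
| "big_and (\<phi> # \<psi> # \<chi>s) = And \<phi> (big_and (\<psi> # \<chi>s))"

fun big_or :: "fm list \<Rightarrow> fm" where
  "big_or [] = Zero"
| "big_or [\<phi>] = \<phi>"
| "big_or (\<phi> # \<psi> # \<chi>s) = Or \<phi> (big_or (\<psi> # \<chi>s))"

(* All conjunctions of the given formulas in which each conjunct is plain or negated. *)
definition signed_conjs :: "fm list \<Rightarrow> fm list" where
  "signed_conjs \<phi>s = map big_and (product_lists (map (\<lambda>\<phi>. [\<phi>, Neg \<phi>]) \<phi>s))"

(* The order in the lists below merely fixes one syntactic representative of each minterm and
   of each DCF formula: the DCF formulas of formulas v d are the formulas big_or ms for
   ms \<in> set (subseqs (minterms v d)), one for every set of level-d minterms. *)
primrec minterms :: "nat \<Rightarrow> nat \<Rightarrow> fm list" where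
  "minterms v 0 = signed_conjs (map Var [0..<v])"
| "minterms v (Suc d) =
     signed_conjs (map Var [0..<v] @ map (\<lambda>ms. Dia (big_or ms)) (subseqs (minterms v d)))"

(* The minterms of the unique DCF formula equivalent to \<phi>; the existence and uniqueness of the
   latter for \<phi> \<in> formulas v d is lemma dcf_unique below. *)
definition minterm_set :: "nat \<Rightarrow> nat \<Rightarrow> fm \<Rightarrow> fm set" where
  "minterm_set v d \<phi> = set (THE ms. ms \<in> set (subseqs (minterms v d)) \<and> \<phi> \<approx> big_or ms)"

definition char_minmatrix :: "nat \<Rightarrow> nat \<Rightarrow> fm set \<Rightarrow> fm set" where
  "char_minmatrix v d S = (\<Inter>\<phi> \<in> S \<inter> formulas v d. minterm_set v d \<phi>)"

definition char_minmatrices :: "nat \<Rightarrow> nat \<Rightarrow> fm set set" where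
  "char_minmatrices v d = {char_minmatrix v d S |S. classical_modal_logic S}"

definition char_minmatrix_lattice :: "nat \<Rightarrow> nat \<Rightarrow> fm set gorder" where
  "char_minmatrix_lattice v d = \<lparr>carrier = char_minmatrices v d, eq = (=), le = (\<subseteq>)\<rparr>"


lemma tval_big_and: "tval V (big_and ms) \<longleftrightarrow> (\<forall>m \<in> set ms. tval V m)"
  by (induction ms rule: big_and.induct) auto

lemma tval_big_or: "tval V (big_or ms) \<longleftrightarrow> (\<exists>m \<in> set ms. tval V m)"
  by (induction ms rule: big_or.induct) auto

lemma tval_subst: "tval V (subst \<sigma> \<phi>) = tval (\<lambda>\<psi>. tval V (subst \<sigma> \<psi>)) \<phi>"
  by (induction \<phi>) auto

lemma E_sound:
  assumes "\<phi> \<in> E" and "\<And>\<alpha> \<beta>. \<alpha> \<approx> \<beta> \<Longrightarrow> V (Dia \<alpha>) = V (Dia \<beta>)"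
  shows "tval V \<phi>"
  using assms
proof (induction arbitrary: V)
  case (us \<phi> \<sigma>)
  have "tval (\<lambda>\<psi>. tval V (subst \<sigma> \<psi>)) \<phi>"
  proof (rule us.IH)
    fix \<alpha> \<beta> assume "\<alpha> \<approx> \<beta>"
    then have "subst \<sigma> \<alpha> \<approx> subst \<sigma> \<beta>"
      using E.us[of "Iff \<alpha> \<beta>" \<sigma>] by (simp add: E_equiv_def)
    from us.prems[OF this]
    show "tval V (subst \<sigma> (Dia \<alpha>)) = tval V (subst \<sigma> (Dia \<beta>))" by simp
  qed
  then show ?case by (subst tval_subst)
next
  case (re \<phi> \<psi>)
  have "V (Dia \<phi>) = V (Dia \<psi>)"
    by (rule re.prems) (simp add: E_equiv_def re.hyps)
  then show ?case by simp
next
  case (mp \<phi> \<psi>)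
  have "tval V \<phi>" "tval V (Imp \<phi> \<psi>)" using mp by blast+
  then show ?case by simp
qed (auto simp: tautology_def)

lemma E_consequence:
  assumes "set \<Gamma> \<subseteq> E" and "\<And>V. \<forall>\<gamma> \<in> set \<Gamma>. tval V \<gamma> \<Longrightarrow> tval V \<phi>"
  shows "\<phi> \<in> E"
  using assms
proof (induction \<Gamma> arbitrary: \<phi>)
  case Nil
  then show ?case by (intro E.taut) (simp add: tautology_def)
next
  case (Cons \<gamma> \<Gamma>)
  have "Imp \<gamma> \<phi> \<in> E"
    using Cons.prems by (intro Cons.IH) auto
  then show ?case using Cons.prems(1) by (auto intro: E.mp)
qed

lemma E_consequence2:
  assumes "\<alpha> \<in> E" "\<beta> \<in> E" and "\<And>V. tval V \<alpha> \<Longrightarrow> tval V \<beta> \<Longrightarrow> tval V \<phi>"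
  shows "\<phi> \<in> E"
proof (rule E_consequence)
  show "set [\<alpha>, \<beta>] \<subseteq> E" using assms(1,2) by simp
  fix V assume "\<forall>\<gamma> \<in> set [\<alpha>, \<beta>]. tval V \<gamma>"
  then show "tval V \<phi>" by (intro assms(3)) simp_all
qed

lemma E_equiv_refl: "\<phi> \<approx> \<phi>"
  unfolding E_equiv_def by (rule E_consequence[of "[]"]) auto

lemma E_equiv_sym: "\<phi> \<approx> \<psi> \<Longrightarrow> \<psi> \<approx> \<phi>"
  unfolding E_equiv_def by (rule E_consequence[of "[Iff \<phi> \<psi>]"]) auto

lemma E_equiv_trans: "\<phi> \<approx> \<psi> \<Longrightarrow> \<psi> \<approx> \<chi> \<Longrightarrow> \<phi> \<approx> \<chi>"
  unfolding E_equiv_def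
  by (erule (1) E_consequence2) (unfold tval.simps, blast)

lemma neg_neq: "\<phi> \<noteq> Neg \<phi>" "Neg \<phi> \<noteq> \<phi>"
  by (induction \<phi>) simp_all

lemma signed_list:
  assumes "ls \<in> set (product_lists (map (\<lambda>\<phi>. [\<phi>, Neg \<phi>]) \<phi>s))"
  shows "(\<forall>l \<in> set ls. tval V l) \<longleftrightarrow> ls = map (\<lambda>\<phi>. if tval V \<phi> then \<phi> else Neg \<phi>) \<phi>s"
  using assms
proof (induction \<phi>s arbitrary: ls)
  case (Cons \<phi> \<phi>s)
  then obtain l ls' where ls: "ls = l # ls'" "l = \<phi> \<or> l = Neg \<phi>"
    "ls' \<in> set (product_lists (map (\<lambda>\<phi>. [\<phi>, Neg \<phi>]) \<phi>s))" by auto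
  have "tval V l \<longleftrightarrow> l = (if tval V \<phi> then \<phi> else Neg \<phi>)"
    using ls(2) neg_neq[of \<phi>] by (elim disjE) simp_all
  then show ?case using Cons.IH[OF ls(3)] by (simp add: ls(1))
qed simp

lemma signed_list_mem:
  "map (\<lambda>\<phi>. if P \<phi> then \<phi> else Neg \<phi>) \<phi>s \<in> set (product_lists (map (\<lambda>\<phi>. [\<phi>, Neg \<phi>]) \<phi>s))"
  by (induction \<phi>s) auto

lemma signed_list_ex:
  assumes "ls \<in> set (product_lists (map (\<lambda>\<phi>. [\<phi>, Neg \<phi>]) \<phi>s))" and "distinct \<phi>s"
  shows "\<exists>P. ls = map (\<lambda>\<phi>. if P \<phi> then \<phi> else Neg \<phi>) \<phi>s"
  using assms
proof (induction \<phi>s arbitrary: ls)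
  case (Cons \<phi> \<phi>s)
  then obtain l ls' where ls: "ls = l # ls'" "l = \<phi> \<or> l = Neg \<phi>"
    "ls' \<in> set (product_lists (map (\<lambda>\<phi>. [\<phi>, Neg \<phi>]) \<phi>s))" by auto
  then obtain P where P: "ls' = map (\<lambda>\<phi>. if P \<phi> then \<phi> else Neg \<phi>) \<phi>s"
    using Cons by force
  have "ls = map (\<lambda>\<psi>. if (P(\<phi> := (l = \<phi>))) \<psi> then \<psi> else Neg \<psi>) (\<phi> # \<phi>s)"
    using ls P Cons.prems(2) by auto
  then show ?case by blast
qed simp

lemma big_and_inj: "length xs = length ys \<Longrightarrow> big_and xs = big_and ys \<Longrightarrow> xs = ys"
proof (induction xs arbitrary: ys rule: big_and.induct)
  case (3 \<phi> \<psi> \<chi>s)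
  then obtain a b c where ys: "ys = a # b # c" by (metis length_Suc_conv)
  then have "\<psi> # \<chi>s = b # c" using 3 by (intro "3.IH") auto
  then show ?case using 3 ys by auto
next
  case (2 \<phi>)
  then obtain a where "ys = [a]" by (cases ys) auto
  then show ?case using 2 by simp
qed simp

lemma distinct_signed_conjs: "distinct (signed_conjs \<phi>s)"
proof -
  have "distinct (product_lists (map (\<lambda>\<phi>. [\<phi>, Neg \<phi>]) \<phi>s))"
  proof (rule distinct_product_lists)
    show "\<forall>xs \<in> set (map (\<lambda>\<phi>. [\<phi>, Neg \<phi>]) \<phi>s). distinct xs" by (auto simp: neg_neq)
  qed
  moreover have "inj_on big_and (set (product_lists (map (\<lambda>\<phi>. [\<phi>, Neg \<phi>]) \<phi>s)))"
    by (intro inj_onI big_and_inj) (simp_all add: in_set_product_lists_length)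
  ultimately show ?thesis by (simp add: signed_conjs_def distinct_map)
qed

lemma signed_conjs_ex: "\<exists>m \<in> set (signed_conjs \<phi>s). tval V m"
proof -
  have "tval V (big_and (map (\<lambda>\<phi>. if tval V \<phi> then \<phi> else Neg \<phi>) \<phi>s))"
    by (auto simp: tval_big_and)
  then show ?thesis using signed_list_mem[of "tval V" \<phi>s] by (auto simp: signed_conjs_def)
qed

lemma signed_conjs_unique:
  assumes "m \<in> set (signed_conjs \<phi>s)" "m' \<in> set (signed_conjs \<phi>s)" "tval V m" "tval V m'"
  shows "m = m'"
  using assms by (auto simp: signed_conjs_def tval_big_and signed_list)

lemma signed_conjs_decide:
  assumes "m \<in> set (signed_conjs \<phi>s)" and "\<phi> \<in> set \<phi>s"
  shows "Imp m \<phi> \<in> E \<or> Imp m (Neg \<phi>) \<in> E"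
proof -
  have "\<phi> \<in> set ls \<or> Neg \<phi> \<in> set ls"
    if "ls \<in> set (product_lists (map (\<lambda>\<phi>. [\<phi>, Neg \<phi>]) \<phi>s))" for ls
    using that assms(2)
  proof (induction \<phi>s arbitrary: ls)
    case (Cons a \<phi>s)
    then obtain l ls' where "ls = l # ls'" "l = a \<or> l = Neg a"
      "ls' \<in> set (product_lists (map (\<lambda>\<phi>. [\<phi>, Neg \<phi>]) \<phi>s))" by auto
    then show ?case using Cons.IH[of ls'] Cons.prems(2) by (cases "\<phi> = a") auto
  qed simp
  then obtain ls where "m = big_and ls" "\<phi> \<in> set ls \<or> Neg \<phi> \<in> set ls"
    using assms(1) by (auto simp: signed_conjs_def)
  then have "(\<forall>V. tval V m \<longrightarrow> tval V \<phi>) \<or> (\<forall>V. tval V m \<longrightarrow> \<not> tval V \<phi>)"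
    by (metis tval_big_and tval.simps(4))
  then have "tautology (Imp m \<phi>) \<or> tautology (Imp m (Neg \<phi>))"
    by (auto simp: tautology_def)
  then show ?thesis by (blast intro: E.taut)
qed

abbreviation atoms :: "nat \<Rightarrow> nat \<Rightarrow> fm list" where
  "atoms v d \<equiv> map Var [0..<v] @
     (case d of 0 \<Rightarrow> [] | Suc e \<Rightarrow> map (\<lambda>ms. Dia (big_or ms)) (subseqs (minterms v e)))"

lemma minterms_atoms: "minterms v d = signed_conjs (atoms v d)"
  by (cases d) auto

lemma distinct_minterms: "distinct (minterms v d)"
  unfolding minterms_atoms[of v d] by (rule distinct_signed_conjs)

lemma tval_dcf:
  assumes "m \<in> set (minterms v d)" "tval V m" "set ms \<subseteq> set (minterms v d)"
  shows "tval V (big_or ms) \<longleftrightarrow> m \<in> set ms"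
proof -
  have "m' = m" if "m' \<in> set ms" "tval V m'" for m'
    using that assms signed_conjs_unique[of m' "atoms v d" m V] unfolding minterms_atoms[of v d] by auto
  then show ?thesis using assms(2) by (auto simp: tval_big_or)
qed

lemma dcf_from_decide:
  assumes "\<And>m. m \<in> set (minterms v d) \<Longrightarrow> Imp m \<phi> \<in> E \<or> Imp m (Neg \<phi>) \<in> E"
  shows "\<exists>ms \<in> set (subseqs (minterms v d)). \<phi> \<approx> big_or ms"
proof -
  obtain ms where ms: "ms \<in> set (subseqs (minterms v d))"
    "set ms = {m \<in> set (minterms v d). Imp m \<phi> \<in> E}"
    using subset_subseqs[of "{m \<in> set (minterms v d). Imp m \<phi> \<in> E}" "minterms v d"] by auto
  define \<Gamma> where "\<Gamma> = map (\<lambda>m. if Imp m \<phi> \<in> E then Imp m \<phi> else Imp m (Neg \<phi>)) (minterms v d)"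
  have "Iff \<phi> (big_or ms) \<in> E"
  proof (rule E_consequence)
    show "set \<Gamma> \<subseteq> E" using assms by (auto simp: \<Gamma>_def)
    fix V assume V: "\<forall>\<gamma> \<in> set \<Gamma>. tval V \<gamma>"
    have V': "tval V (if Imp m \<phi> \<in> E then Imp m \<phi> else Imp m (Neg \<phi>))"
      if "m \<in> set (minterms v d)" for m using that by (intro V[rule_format]) (auto simp: \<Gamma>_def)
    obtain m where m: "m \<in> set (minterms v d)" "tval V m"
      using signed_conjs_ex[of "atoms v d" V] unfolding minterms_atoms[of v d] by blast
    have "tval V (big_or ms) \<longleftrightarrow> m \<in> set ms"
      using tval_dcf[OF m] ms(2) by simp
    moreover have "tval V \<phi> \<longleftrightarrow> m \<in> set ms"
      using V'[OF m(1)] m ms(2) by (auto split: if_splits)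
    ultimately show "tval V (Iff \<phi> (big_or ms))" by simp
  qed
  then show ?thesis using ms(1) by (auto simp: E_equiv_def)
qed

lemma E_imp:
  "Imp m \<phi> \<in> E \<Longrightarrow> (\<And>V. tval V \<phi> \<Longrightarrow> tval V \<chi>) \<Longrightarrow> Imp m \<chi> \<in> E"
  by (rule E_consequence[of "[Imp m \<phi>]"]) auto

lemma E_imp2:
  "Imp m \<phi> \<in> E \<Longrightarrow> Imp m \<psi> \<in> E \<Longrightarrow> (\<And>V. tval V \<phi> \<Longrightarrow> tval V \<psi> \<Longrightarrow> tval V \<chi>)
     \<Longrightarrow> Imp m \<chi> \<in> E"
  by (erule (1) E_consequence2) (unfold tval.simps, blast)

lemma minterms_decide:
  assumes "\<phi> \<in> formulas v d" and "m \<in> set (minterms v d)"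
  shows "Imp m \<phi> \<in> E \<or> Imp m (Neg \<phi>) \<in> E"
  using assms
proof (induction \<phi> arbitrary: d m)
  case (Var i)
  then show ?case
    unfolding minterms_atoms[of v d] by (intro signed_conjs_decide) (auto simp: formulas_def)
next
  case Zero
  show ?case by (rule disjI2, rule E_consequence[of "[]"]) auto
next
  case One
  show ?case by (rule disjI1, rule E_consequence[of "[]"]) auto
next
  case (Neg \<phi>)
  then have "Imp m \<phi> \<in> E \<or> Imp m (Neg \<phi>) \<in> E" by (auto simp: formulas_def)
  then show ?case
  proof
    assume "Imp m \<phi> \<in> E"
    then have "Imp m (Neg (Neg \<phi>)) \<in> E" by (rule E_imp) simp
    then show ?case ..
  qed simp
next
  case (Or \<phi> \<psi>)
  then consider "Imp m \<phi> \<in> E" | "Imp m \<psi> \<in> E" | "Imp m (Neg \<phi>) \<in> E" "Imp m (Neg \<psi>) \<in> E"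
    by (auto simp: formulas_def)
  then show ?case
  proof cases
    case 1
    then have "Imp m (Or \<phi> \<psi>) \<in> E" by (rule E_imp) simp
    then show ?thesis ..
  next
    case 2
    then have "Imp m (Or \<phi> \<psi>) \<in> E" by (rule E_imp) simp
    then show ?thesis ..
  next
    case 3
    then have "Imp m (Neg (Or \<phi> \<psi>)) \<in> E" by (rule E_imp2) simp
    then show ?thesis ..
  qed
next
  case (And \<phi> \<psi>)
  then consider "Imp m (Neg \<phi>) \<in> E" | "Imp m (Neg \<psi>) \<in> E" | "Imp m \<phi> \<in> E" "Imp m \<psi> \<in> E"
    by (auto simp: formulas_def)
  then show ?case
  proof cases
    case 1
    then have "Imp m (Neg (And \<phi> \<psi>)) \<in> E" by (rule E_imp) simp
    then show ?thesis ..
  next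
    case 2
    then have "Imp m (Neg (And \<phi> \<psi>)) \<in> E" by (rule E_imp) simp
    then show ?thesis ..
  next
    case 3
    then have "Imp m (And \<phi> \<psi>) \<in> E" by (rule E_imp2) simp
    then show ?thesis ..
  qed
next
  case (Dia \<phi>)
  then obtain e where d: "d = Suc e" "\<phi> \<in> formulas v e"
    by (cases d) (auto simp: formulas_def)
  obtain ms where ms: "ms \<in> set (subseqs (minterms v e))" "\<phi> \<approx> big_or ms"
    using dcf_from_decide[of v e \<phi>] Dia.IH d(2) by blast
  have eq: "Iff (Dia \<phi>) (Dia (big_or ms)) \<in> E"
    using ms(2) by (auto simp: E_equiv_def intro: E.re)
  have "Imp m (Dia (big_or ms)) \<in> E \<or> Imp m (Neg (Dia (big_or ms))) \<in> E"
    using Dia.prems(2) ms(1) unfolding d(1) minterms.simps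
    by (intro signed_conjs_decide) auto
  then show ?case
  proof
    assume "Imp m (Dia (big_or ms)) \<in> E"
    then have "Imp m (Dia \<phi>) \<in> E"
      by (rule E_consequence2[OF eq]) (unfold tval.simps, blast)
    then show ?case ..
  next
    assume "Imp m (Neg (Dia (big_or ms))) \<in> E"
    then have "Imp m (Neg (Dia \<phi>)) \<in> E"
      by (rule E_consequence2[OF eq]) (unfold tval.simps, blast)
    then show ?case ..
  qed
qed

lemma dcf_inj:
  assumes "ms \<in> set (subseqs (minterms v d))" "ms' \<in> set (subseqs (minterms v d))"
    and "big_or ms \<approx> big_or ms'"
  shows "ms = ms'"
  using assms
proof (induction d arbitrary: ms ms' rule: less_induct)
  case (less d)
  have IH: "xs = ys"
    if "d = Suc e" "xs \<in> set (subseqs (minterms v e))" "ys \<in> set (subseqs (minterms v e))"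
      "big_or xs \<approx> big_or ys" for e xs ys
    using less.IH[of e] that by blast
  have sub: "set ms \<subseteq> set (minterms v d)" "set ms' \<subseteq> set (minterms v d)"
    using less.prems(1,2) subseqs_powset[of "minterms v d"] by blast+
  have "distinct (atoms v d)"
  proof (cases d)
    case (Suc e)
    have "inj_on (\<lambda>ms. Dia (big_or ms)) (set (subseqs (minterms v e)))"
      using IH[OF Suc] E_equiv_refl by (auto intro!: inj_onI)
    moreover have "distinct (subseqs (minterms v e))"
      using distinct_set_subseqs[OF distinct_minterms] distinct_map by blast
    ultimately show ?thesis using Suc by (auto simp: distinct_map inj_on_def)
  qed (auto simp: distinct_map inj_on_def)
  have "m \<in> set ms \<longleftrightarrow> m \<in> set ms'" if m: "m \<in> set (minterms v d)" for m
  proof -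
    obtain ls where ls: "m = big_and ls"
      "ls \<in> set (product_lists (map (\<lambda>\<phi>. [\<phi>, Neg \<phi>]) (atoms v d)))"
      using m unfolding minterms_atoms[of v d] signed_conjs_def by auto
    obtain P where P: "ls = map (\<lambda>\<phi>. if P \<phi> then \<phi> else Neg \<phi>) (atoms v d)"
      using signed_list_ex[OF ls(2) \<open>distinct (atoms v d)\<close>] by blast
    define V where "V \<phi> = (case \<phi> of Dia \<psi> \<Rightarrow>
        \<exists>e xs. d = Suc e \<and> xs \<in> set (subseqs (minterms v e)) \<and> \<psi> \<approx> big_or xs \<and> P (Dia (big_or xs))
      | _ \<Rightarrow> P \<phi>)" for \<phi>
    have cong: "V (Dia \<alpha>) = V (Dia \<beta>)" if "\<alpha> \<approx> \<beta>" for \<alpha> \<beta>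
    proof -
      have "\<alpha> \<approx> \<chi> \<longleftrightarrow> \<beta> \<approx> \<chi>" for \<chi>
        using that E_equiv_trans E_equiv_sym by blast
      then show ?thesis by (simp add: V_def)
    qed
    have "tval V a = P a" if "a \<in> set (atoms v d)" for a
    proof (cases "\<exists>i. a = Var i")
      case False
      then obtain e xs where a: "d = Suc e" "xs \<in> set (subseqs (minterms v e))" "a = Dia (big_or xs)"
        using \<open>a \<in> set (atoms v d)\<close> by (auto split: nat.splits)
      then show ?thesis
        using IH[OF a(1,2)] E_equiv_refl by (auto simp: V_def)
    qed (auto simp: V_def)
    then have "ls = map (\<lambda>\<phi>. if tval V \<phi> then \<phi> else Neg \<phi>) (atoms v d)"
      unfolding P by (intro map_cong) auto
    then have Vm: "tval V m"
      using signed_list[OF ls(2)] by (simp add: ls(1) tval_big_and)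
    have "tval V (big_or xs) \<longleftrightarrow> m \<in> set xs" if "set xs \<subseteq> set (minterms v d)" for xs
      using tval_dcf[OF m Vm that] .
    moreover have "tval V (big_or ms) \<longleftrightarrow> tval V (big_or ms')"
      using E_sound[of "Iff (big_or ms) (big_or ms')" V] cong less.prems(3)
      by (auto simp: E_equiv_def)
    ultimately show ?thesis using sub by blast
  qed
  then have "set ms = set ms'" using sub by blast
  then show ?case
    using distinct_set_subseqs[OF distinct_minterms, of v d] less.prems(1,2)
    by (auto simp: distinct_map inj_on_def)
qed

lemma dcf_unique:
  assumes "\<phi> \<in> formulas v d"
  shows "\<exists>!ms. ms \<in> set (subseqs (minterms v d)) \<and> \<phi> \<approx> big_or ms"
proof (rule ex_ex1I)
  show "\<exists>ms. ms \<in> set (subseqs (minterms v d)) \<and> \<phi> \<approx> big_or ms"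
    using dcf_from_decide[of v d \<phi>] minterms_decide[OF assms] by blast
  show "ms = ms'"
    if "ms \<in> set (subseqs (minterms v d)) \<and> \<phi> \<approx> big_or ms"
      "ms' \<in> set (subseqs (minterms v d)) \<and> \<phi> \<approx> big_or ms'" for ms ms'
    using that E_equiv_trans[of "big_or ms" \<phi> "big_or ms'"]
    by (intro dcf_inj[of ms v d ms']) (simp_all add: E_equiv_sym)
qed

end

theory Submission
  imports Defs
begin

text \<open>
  A formula of \<open>formulas v d\<close> is a theorem of \<open>S\<close> iff its minterm set contains
  \<open>\<langle>S\<rangle>\<close>, because \<open>S\<close> refutes every minterm outside \<open>\<langle>S\<rangle>\<close>.
  The union of \<open>\<langle>S'\<rangle>\<close> and \<open>\<langle>S''\<rangle>\<close> belongs to the logic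
  \<open>S' \<inter> S''\<close>: a disjunction of an \<open>S'\<close>-theorem and an \<open>S''\<close>-theorem is a
  theorem of both logics. The meet belongs to the logic generated by the
  theorems of \<open>S'\<close> and \<open>S''\<close> \<^emph>\<open>inside\<close> \<open>formulas v d\<close>; the logic generated by all of
  \<open>S' \<union> S''\<close> could have too small a minmatrix.
\<close>

text \<open>Premises are moved one at a time behind an implication until a tautology remains; modus
  ponens recovers them. Formulas \<open>Dia \<phi>\<close> count as atoms for \<open>tval\<close>,
  so propositional reasoning inside a logic reduces to checking valuations.\<close>

lemma classical_modal_logic_consequence:
  assumes "classical_modal_logic S" "set \<Gamma> \<subseteq> S"
    and "\<And>V. \<forall>\<gamma> \<in> set \<Gamma>. tval V \<gamma> \<Longrightarrow> tval V \<phi>"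
  shows "\<phi> \<in> S"
  using assms(2,3)
proof (induction \<Gamma> arbitrary: \<phi>)
  case Nil
  then have "\<phi> \<in> E" by (intro E.taut) (simp add: tautology_def)
  then show ?case using assms(1) by (auto simp: classical_modal_logic_def)
next
  case (Cons \<gamma> \<Gamma>)
  have "Imp \<gamma> \<phi> \<in> S"
    using Cons.prems by (intro Cons.IH) auto
  moreover have "\<gamma> \<in> S" using Cons.prems(1) by simp
  ultimately show ?case
    using assms(1) unfolding classical_modal_logic_def by meson
qed

text \<open>Every clause of the definition is a closure condition, hence survives intersection. This
  serves both the intersection of two logics and the logic generated by a set of formulas.\<close>

lemma classical_modal_logic_Inter:
  assumes "\<And>S. S \<in> \<S> \<Longrightarrow> classical_modal_logic S"
  shows "classical_modal_logic (\<Inter>\<S>)"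
  unfolding classical_modal_logic_def
proof (intro conjI allI impI)
  show "E \<subseteq> \<Inter>\<S>"
    using assms unfolding classical_modal_logic_def by (meson Inter_greatest)
  show "\<psi> \<in> \<Inter>\<S>" if "\<phi> \<in> \<Inter>\<S>" "Imp \<phi> \<psi> \<in> \<Inter>\<S>" for \<phi> \<psi>
    using that assms unfolding classical_modal_logic_def by (meson InterE InterI)
  show "subst \<sigma> \<phi> \<in> \<Inter>\<S>" if "\<phi> \<in> \<Inter>\<S>" for \<phi> \<sigma>
    using that assms unfolding classical_modal_logic_def by (meson InterE InterI)
  show "Iff (Dia \<phi>) (Dia \<psi>) \<in> \<Inter>\<S>" if "Iff \<phi> \<psi> \<in> \<Inter>\<S>" for \<phi> \<psi>
    using that assms unfolding classical_modal_logic_def by (meson InterE InterI)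
qed

lemma minterm_setE:
  assumes "\<phi> \<in> formulas v d"
  obtains ms where "ms \<in> set (subseqs (minterms v d))" "\<phi> \<approx> big_or ms"
    "minterm_set v d \<phi> = set ms"
  using theI'[OF dcf_unique[OF assms]] unfolding minterm_set_def by blast

lemma minterm_set_eqI:
  assumes "\<phi> \<in> formulas v d" "ms \<in> set (subseqs (minterms v d))" "\<phi> \<approx> big_or ms"
  shows "minterm_set v d \<phi> = set ms"
  using the1_equality[OF dcf_unique[OF assms(1)]] assms(2,3) by (auto simp: minterm_set_def)

lemma minterm_set_subset:
  assumes "\<phi> \<in> formulas v d"
  shows "minterm_set v d \<phi> \<subseteq> set (minterms v d)"
proof -
  obtain ms where "ms \<in> set (subseqs (minterms v d))" "minterm_set v d \<phi> = set ms"
    by (rule minterm_setE[OF assms])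
  then show ?thesis using subseqs_powset[of "minterms v d"] by blast
qed

lemma minterm_set_Or:
  assumes "\<phi> \<in> formulas v d" "\<psi> \<in> formulas v d"
  shows "minterm_set v d (Or \<phi> \<psi>) = minterm_set v d \<phi> \<union> minterm_set v d \<psi>"
proof -
  obtain xs where xs: "xs \<in> set (subseqs (minterms v d))" "\<phi> \<approx> big_or xs"
      "minterm_set v d \<phi> = set xs"
    by (rule minterm_setE[OF assms(1)])
  obtain ys where ys: "ys \<in> set (subseqs (minterms v d))" "\<psi> \<approx> big_or ys"
      "minterm_set v d \<psi> = set ys"
    by (rule minterm_setE[OF assms(2)])
  have "set xs \<union> set ys \<subseteq> set (minterms v d)"
    using minterm_set_subset assms xs(3) ys(3) by blast
  \<comment> \<open>DCF formulas list their minterms in the fixed order of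
    \<open>minterms v d\<close>, so \<open>xs @ ys\<close> need not be one; the union is listed
    again in that order.\<close>
  then obtain zs where zs: "zs \<in> set (subseqs (minterms v d))" "set zs = set xs \<union> set ys"
    using subset_subseqs by (metis imageE)
  have "Or \<phi> \<psi> \<approx> big_or zs"
    unfolding E_equiv_def
  proof (rule E_consequence2)
    show "Iff \<phi> (big_or xs) \<in> E" "Iff \<psi> (big_or ys) \<in> E"
      using xs ys by (auto simp: E_equiv_def)
  qed (auto simp: tval_big_or zs(2))
  moreover have "Or \<phi> \<psi> \<in> formulas v d" using assms by (auto simp: formulas_def)
  ultimately show ?thesis using minterm_set_eqI zs xs(3) ys(3) by metis
qed

lemma char_minmatrix_antimono: "S \<subseteq> T \<Longrightarrow> char_minmatrix v d T \<subseteq> char_minmatrix v d S"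
  by (auto simp: char_minmatrix_def)

text \<open>Thus the minmatrix determines all theorems of the logic in \<open>formulas v d\<close>;
  the meet needs this to turn inclusions of minmatrices back into theoremhood.\<close>

lemma theorem_iff_char_minmatrix_subset:
  assumes S: "classical_modal_logic S" and \<phi>: "\<phi> \<in> formulas v d"
  shows "\<phi> \<in> S \<longleftrightarrow> char_minmatrix v d S \<subseteq> minterm_set v d \<phi>"
proof
  show "\<phi> \<in> S \<Longrightarrow> char_minmatrix v d S \<subseteq> minterm_set v d \<phi>"
    using \<phi> by (auto simp: char_minmatrix_def)
next
  assume sub: "char_minmatrix v d S \<subseteq> minterm_set v d \<phi>"
  have E: "E \<subseteq> S" using S by (simp add: classical_modal_logic_def)
  \<comment> \<open>Some theorem \<psi> omits m from its minterms. Distinct minterms exclude each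
    other, so a valuation satisfying m falsifies the DCF of \<psi>.\<close>
  have refuted: "Neg m \<in> S" if m: "m \<in> set (minterms v d)" "m \<notin> char_minmatrix v d S" for m
  proof -
    obtain \<psi> where \<psi>: "\<psi> \<in> S" "\<psi> \<in> formulas v d" "m \<notin> minterm_set v d \<psi>"
      using m(2) by (auto simp: char_minmatrix_def)
    obtain ms where ms: "ms \<in> set (subseqs (minterms v d))" "\<psi> \<approx> big_or ms"
        "minterm_set v d \<psi> = set ms"
      by (rule minterm_setE[OF \<psi>(2)])
    show ?thesis
    proof (rule classical_modal_logic_consequence[OF S])
      show "set [\<psi>, Iff \<psi> (big_or ms)] \<subseteq> S" using \<psi>(1) ms(2) E by (auto simp: E_equiv_def)
      fix V assume "\<forall>\<gamma> \<in> set [\<psi>, Iff \<psi> (big_or ms)]. tval V \<gamma>"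
      then have "tval V (big_or ms)" by simp
      then show "tval V (Neg m)"
        using tval_dcf[OF m(1), of V ms] minterm_set_subset[OF \<psi>(2)] \<psi>(3) ms(3) by auto
    qed
  qed
  obtain ms where ms: "ms \<in> set (subseqs (minterms v d))" "\<phi> \<approx> big_or ms"
      "minterm_set v d \<phi> = set ms"
    by (rule minterm_setE[OF \<phi>])
  \<comment> \<open>Each valuation satisfies some minterm; the finitely many negations in \<Gamma>
    force it to be one in the minmatrix, hence a disjunct of the DCF of \<phi>.\<close>
  define \<Gamma> where "\<Gamma> = map Neg (filter (\<lambda>m. m \<notin> char_minmatrix v d S) (minterms v d))"
  show "\<phi> \<in> S"
  proof (rule classical_modal_logic_consequence[OF S])
    show "set (Iff \<phi> (big_or ms) # \<Gamma>) \<subseteq> S"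
      using ms(2) E refuted by (auto simp: \<Gamma>_def E_equiv_def)
    fix V assume V: "\<forall>\<gamma> \<in> set (Iff \<phi> (big_or ms) # \<Gamma>). tval V \<gamma>"
    obtain m where m: "m \<in> set (minterms v d)" "tval V m"
      using signed_conjs_ex[of "atoms v d" V] unfolding minterms_atoms[of v d] by blast
    then have "m \<in> char_minmatrix v d S" using V by (auto simp: \<Gamma>_def)
    then have "tval V (big_or ms)" using sub m(2) ms(3) by (auto simp: tval_big_or)
    then show "tval V \<phi>" using V by simp
  qed
qed

lemma char_minmatrix_Int:
  assumes "classical_modal_logic S" "classical_modal_logic T"
  shows "char_minmatrix v d (S \<inter> T) = char_minmatrix v d S \<union> char_minmatrix v d T"
proof (intro equalityI subsetI)
  fix m assume m: "m \<in> char_minmatrix v d (S \<inter> T)"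
  show "m \<in> char_minmatrix v d S \<union> char_minmatrix v d T"
  proof (rule ccontr)
    assume "m \<notin> char_minmatrix v d S \<union> char_minmatrix v d T"
    then obtain \<phi> \<psi> where
      \<phi>: "\<phi> \<in> S" "\<phi> \<in> formulas v d" "m \<notin> minterm_set v d \<phi>" and
      \<psi>: "\<psi> \<in> T" "\<psi> \<in> formulas v d" "m \<notin> minterm_set v d \<psi>"
      by (auto simp: char_minmatrix_def)
    have "Or \<phi> \<psi> \<in> S"
      using \<phi>(1) by (intro classical_modal_logic_consequence[OF assms(1), of "[\<phi>]"]) auto
    moreover have "Or \<phi> \<psi> \<in> T"
      using \<psi>(1) by (intro classical_modal_logic_consequence[OF assms(2), of "[\<psi>]"]) auto
    moreover have "Or \<phi> \<psi> \<in> formulas v d" using \<phi>(2) \<psi>(2) by (auto simp: formulas_def)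
    ultimately have "m \<in> minterm_set v d (Or \<phi> \<psi>)" using m by (auto simp: char_minmatrix_def)
    then show False using \<phi> \<psi> by (simp add: minterm_set_Or)
  qed
next
  show "m \<in> char_minmatrix v d (S \<inter> T)"
    if "m \<in> char_minmatrix v d S \<union> char_minmatrix v d T" for m
    using that char_minmatrix_antimono[of "S \<inter> T"] by blast
qed

lemma char_minmatrices_Un:
  assumes "A \<in> char_minmatrices v d" "B \<in> char_minmatrices v d"
  shows "A \<union> B \<in> char_minmatrices v d"
proof -
  obtain S T where S: "classical_modal_logic S" "A = char_minmatrix v d S"
    and T: "classical_modal_logic T" "B = char_minmatrix v d T"
    using assms by (auto simp: char_minmatrices_def)
  have "classical_modal_logic (S \<inter> T)"
    using classical_modal_logic_Inter[of "{S, T}"] S(1) T(1) by auto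
  then show ?thesis
    using char_minmatrix_Int[OF S(1) T(1)] S(2) T(2) by (auto simp: char_minmatrices_def)
qed

lemma char_minmatrices_glb:
  assumes "A \<in> char_minmatrices v d" "B \<in> char_minmatrices v d"
  obtains C where "C \<in> char_minmatrices v d" "C \<subseteq> A" "C \<subseteq> B"
    "\<And>D. D \<in> char_minmatrices v d \<Longrightarrow> D \<subseteq> A \<Longrightarrow> D \<subseteq> B \<Longrightarrow> D \<subseteq> C"
proof -
  obtain S T where S: "classical_modal_logic S" "A = char_minmatrix v d S"
    and T: "classical_modal_logic T" "B = char_minmatrix v d T"
    using assms by (auto simp: char_minmatrices_def)
  \<comment> \<open>A competing logic R is known only through its minmatrix, which controls its
    theorems in \<open>formulas v d\<close> and no others. With the generators confined to that set,
    U can be compared with R.\<close>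
  define U where
    "U = \<Inter>{R. classical_modal_logic R \<and> (S \<union> T) \<inter> formulas v d \<subseteq> R}"
  have U: "classical_modal_logic U"
    unfolding U_def by (rule classical_modal_logic_Inter) simp
  have gen: "(S \<union> T) \<inter> formulas v d \<subseteq> U" by (auto simp: U_def)
  show thesis
  proof
    show "char_minmatrix v d U \<in> char_minmatrices v d"
      using U by (auto simp: char_minmatrices_def)
    show "char_minmatrix v d U \<subseteq> A" "char_minmatrix v d U \<subseteq> B"
      using gen by (auto simp: char_minmatrix_def S(2) T(2))
    fix D assume "D \<in> char_minmatrices v d" and sub: "D \<subseteq> A" "D \<subseteq> B"
    then obtain R where R: "classical_modal_logic R" "D = char_minmatrix v d R"
      by (auto simp: char_minmatrices_def)
    have "(S \<union> T) \<inter> formulas v d \<subseteq> R"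
    proof
      fix \<phi> assume \<phi>: "\<phi> \<in> (S \<union> T) \<inter> formulas v d"
      then have "A \<subseteq> minterm_set v d \<phi> \<or> B \<subseteq> minterm_set v d \<phi>"
        by (auto simp: S(2) T(2) char_minmatrix_def)
      then have "char_minmatrix v d R \<subseteq> minterm_set v d \<phi>"
        using sub R(2) by auto
      then show "\<phi> \<in> R"
        using theorem_iff_char_minmatrix_subset[OF R(1), of \<phi> v d] \<phi> by simp
    qed
    then have "U \<subseteq> R" using R(1) by (auto simp: U_def)
    then show "D \<subseteq> char_minmatrix v d U"
      unfolding R(2) by (rule char_minmatrix_antimono)
  qed
qed

text \<open>The order is inclusion, so a union lying in the carrier is automatically the least upper
  bound.\<close>

lemma least_char_minmatrix_lattice_Un:
  assumes "A \<in> char_minmatrices v d" "B \<in> char_minmatrices v d"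
  shows "least (char_minmatrix_lattice v d) (A \<union> B) (Upper (char_minmatrix_lattice v d) {A, B})"
  using assms char_minmatrices_Un[OF assms]
  by (auto simp: least_def Upper_def char_minmatrix_lattice_def)

text \<open>Join and meet are choices of a least upper and a greatest lower bound; they carry
  information only once such bounds exist.\<close>

lemma lattice_char_minmatrix_lattice: "lattice (char_minmatrix_lattice v d)"
proof -
  interpret partial_order "char_minmatrix_lattice v d"
    by unfold_locales (auto simp: char_minmatrix_lattice_def)
  show ?thesis
  proof unfold_locales
    fix A B
    assume "A \<in> carrier (char_minmatrix_lattice v d)" "B \<in> carrier (char_minmatrix_lattice v d)"
    then have AB: "A \<in> char_minmatrices v d" "B \<in> char_minmatrices v d"
      by (simp_all add: char_minmatrix_lattice_def)
    show "\<exists>C. least (char_minmatrix_lattice v d) C (Upper (char_minmatrix_lattice v d) {A, B})"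
      using least_char_minmatrix_lattice_Un[OF AB] by blast
    obtain C where "C \<in> char_minmatrices v d" "C \<subseteq> A" "C \<subseteq> B"
      "\<And>D. D \<in> char_minmatrices v d \<Longrightarrow> D \<subseteq> A \<Longrightarrow> D \<subseteq> B \<Longrightarrow> D \<subseteq> C"
      using char_minmatrices_glb[OF AB] by metis
    then have "greatest (char_minmatrix_lattice v d) C
        (Lower (char_minmatrix_lattice v d) {A, B})"
      using AB by (auto simp: greatest_def Lower_def char_minmatrix_lattice_def)
    then show "\<exists>C. greatest (char_minmatrix_lattice v d) C
        (Lower (char_minmatrix_lattice v d) {A, B})" by blast
  qed
qed

theorem theorem2:
  fixes v d :: nat and S' S'' :: "fm set"
  assumes "classical_modal_logic S'" and "classical_modal_logic S''"
  shows "lattice (char_minmatrix_lattice v d) \<and>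
    (char_minmatrix v d S' \<squnion>\<^bsub>char_minmatrix_lattice v d\<^esub> char_minmatrix v d S''
       = char_minmatrix v d S' \<union> char_minmatrix v d S'' \<and>
     char_minmatrix v d S' \<union> char_minmatrix v d S'' \<in> char_minmatrices v d) \<and>
    char_minmatrix v d S' \<sqinter>\<^bsub>char_minmatrix_lattice v d\<^esub> char_minmatrix v d S''
      \<subseteq> char_minmatrix v d S' \<inter> char_minmatrix v d S''"
proof -
  let ?L = "char_minmatrix_lattice v d"
  let ?A = "char_minmatrix v d S'" and ?B = "char_minmatrix v d S''"
  interpret lattice ?L by (rule lattice_char_minmatrix_lattice)
  have AB: "?A \<in> char_minmatrices v d" "?B \<in> char_minmatrices v d"
    using assms by (auto simp: char_minmatrices_def)
  then have car: "?A \<in> carrier ?L" "?B \<in> carrier ?L"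
    by (simp_all add: char_minmatrix_lattice_def)
  \<comment> \<open>Least upper bounds are unique in a partial order, so the chosen join is the
    union.\<close>
  have "?A \<squnion>\<^bsub>?L\<^esub> ?B = ?A \<union> ?B"
    using least_unique[OF sup_of_two_least[OF car] least_char_minmatrix_lattice_Un[OF AB]]
    by (simp add: join_def)
  moreover have "?A \<sqinter>\<^bsub>?L\<^esub> ?B \<subseteq> ?A \<inter> ?B"
    using meet_left[OF car] meet_right[OF car] by (simp add: char_minmatrix_lattice_def)
  ultimately show ?thesis
    using lattice_axioms char_minmatrices_Un[OF AB] by blast
qed

end
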